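(* Let $G_1$ and $G_2$ be vertex-disjoint graphs on $n_1$ and $n_2$ vertices respectively. Then, as identities of rational functions in $x$: (a) $$f_{A(G_1\underset{=}{\vee}G_2)}(x)=x^{n_1}\,f_{A(G_2)}(x)\,\det\!\Big(xI_{n_1}-A(G_1)-\tfrac1x A^2(\overline{G_1})\Big)\Big[1-\Gamma_{A(G_2)}(x)\,\Gamma_{A(G_1)+\frac1x A^2(\overline{G_1})}(x)\Big].$$ (b) $$f_{A(G_1\veebar G_2)}(x)=x^{n_1}\,f_{A(G_2)}(x)\,\det\!\Big(xI_{n_1}-A(G_1)-\tfrac1x A^2(G_1)\Big)\Big[1-\Gamma_{A(G_2)}(x)\,\Gamma_{A(G_1)+\frac1x A^2(G_1)}(x)\Big].$$
   Context: Graphs are finite, undirected and simple. $A(G)$ is the adjacency matrix of $G$, $\overline{G}$ is the complement of $G$, and $A^2(G)=(A(G))^2$. For an $n\times n$ matrix $M$, $f_M(x)=\det(xI_n-M)$, and the coronal of $M$ is $\Gamma_M(x)=\mathbf 1_n^T(xI_n-M)^{-1}\mathbf 1_n$, where $\mathbf 1_n$ is the all-ones column. When the entries of $M$ themselves depend on $x$, $\Gamma_M(x)$ means $\mathbf 1_n^T(xI_n-M)^{-1}\mathbf 1_n$ with that same $x$. Let $V(G_1)=\{u_1,\dots,u_{n_1}\}$. The join $G_1\vee G_2$ is the disjoint union of $G_1$ and $G_2$ together with all edges between $V(G_1)$ and $V(G_2)$. The NS (Neighbors Splitting) join $G_1\veebar G_2$ is obtained from $G_1\vee G_2$ by adding new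 vertices $u_1',\dots,u_{n_1}'$ and joining $u_i'$ to $u_j$ if and only if $u_iu_j\in E(G_1)$. The NNS (Non Neighbors Splitting) join $G_1\underset{=}{\vee}G_2$ is obtained from $G_1\vee G_2$ by adding new vertices $u_1',\dots,u_{n_1}'$ and joining $u_i'$ to $u_j$ if and only if $i\ne j$ and $u_iu_j\notin E(G_1)$. *)

theory Defs
  imports
    "Graph_Theory.Pair_Digraph"
    "Jordan_Normal_Form.Char_Poly"
    "Jordan_Normal_Form.Gauss_Jordan_Elimination"
    "HOL-Computational_Algebra.Normalized_Fraction"
begin

text \<open>
  A finite simple undirected graph is a \<^locale>\<open>pair_graph\<close>: an undirected edge \<open>uv\<close> is the pair
  of arcs \<open>(u, v)\<close> and \<open>(v, u)\<close>.
\<close>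

definition graph_complement :: "'a pair_pre_digraph \<Rightarrow> 'a pair_pre_digraph" where
  "graph_complement G =
     \<lparr> pverts = pverts G,
       parcs = {(u, v). u \<in> pverts G \<and> v \<in> pverts G \<and> u \<noteq> v \<and> (u, v) \<notin> parcs G} \<rparr>"

text \<open>
  This is the join of the two graphs only if their vertex sets are disjoint.
\<close>

definition graph_join :: "'a pair_pre_digraph \<Rightarrow> 'a pair_pre_digraph \<Rightarrow> 'a pair_pre_digraph" where
  "graph_join G1 G2 =
     \<lparr> pverts = pverts G1 \<union> pverts G2,
       parcs = parcs G1 \<union> parcs G2
         \<union> pverts G1 \<times> pverts G2 \<union> pverts G2 \<times> pverts G1 \<rparr>"

text \<open>
  \<open>Copy u\<close> is the new vertex \<open>u'\<close> belonging to the vertex \<open>u\<close> of the first graph.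
\<close>

datatype 'a split_vertex = Orig 'a | Copy 'a

definition splitting_join ::
  "('a \<Rightarrow> 'a \<Rightarrow> bool) \<Rightarrow> 'a pair_pre_digraph \<Rightarrow> 'a pair_pre_digraph
     \<Rightarrow> 'a split_vertex pair_pre_digraph" where
  "splitting_join R G1 G2 =
     \<lparr> pverts = Orig ` pverts (graph_join G1 G2) \<union> Copy ` pverts G1,
       parcs = {(Orig u, Orig v) | u v. (u, v) \<in> parcs (graph_join G1 G2)}
         \<union> {(Copy u, Orig v) | u v. u \<in> pverts G1 \<and> v \<in> pverts G1 \<and> R u v}
         \<union> {(Orig v, Copy u) | u v. u \<in> pverts G1 \<and> v \<in> pverts G1 \<and> R u v} \<rparr>"

definition NS_join ::
  "'a pair_pre_digraph \<Rightarrow> 'a pair_pre_digraph \<Rightarrow> 'a split_vertex pair_pre_digraph" where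
  "NS_join G1 G2 = splitting_join (\<lambda>u v. (u, v) \<in> parcs G1) G1 G2"

definition NNS_join ::
  "'a pair_pre_digraph \<Rightarrow> 'a pair_pre_digraph \<Rightarrow> 'a split_vertex pair_pre_digraph" where
  "NNS_join G1 G2 = splitting_join (\<lambda>u v. u \<noteq> v \<and> (u, v) \<notin> parcs G1) G1 G2"

definition vertex_enum :: "'a list \<Rightarrow> 'a pair_pre_digraph \<Rightarrow> bool" where
  "vertex_enum vs G \<longleftrightarrow> distinct vs \<and> set vs = pverts G"

definition adjacency_matrix :: "'a list \<Rightarrow> 'a pair_pre_digraph \<Rightarrow> real mat" where
  "adjacency_matrix vs G =
     mat (length vs) (length vs) (\<lambda>(i, j). if (vs ! i, vs ! j) \<in> parcs G then 1 else 0)"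

text \<open>
  Rational functions in \<open>x\<close> are elements of the field of fractions of \<open>real poly\<close>.
\<close>

type_synonym ratfun = "real poly fract"

definition ratfun_x :: ratfun where
  "ratfun_x = to_fract [:0, 1:]"

definition ratfun_mat :: "real mat \<Rightarrow> ratfun mat" where
  "ratfun_mat = map_mat (\<lambda>c. to_fract [:c:])"

text \<open>
  The entries of \<open>M\<close> may themselves involve \<open>x\<close>. The inverse is taken over the field of rational
  functions; the value is meaningful only if \<open>x I - M\<close> is invertible there, as it always is when
  \<open>M\<close> does not depend on \<open>x\<close>.
\<close>

definition coronal :: "ratfun mat \<Rightarrow> ratfun" where
  "coronal M =
     (let n = dim_row M; ones = vec n (\<lambda>_. 1)
      in ones \<bullet> (the (mat_inverse (ratfun_x \<cdot>\<^sub>m 1\<^sub>m n - M)) *\<^sub>v ones))"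

lemma coronal_eqI:
  assumes M: "M \<in> carrier_mat n n" and B: "B \<in> carrier_mat n n"
    and inv: "(ratfun_x \<cdot>\<^sub>m 1\<^sub>m n - M) * B = 1\<^sub>m n"
  shows "coronal M = vec n (\<lambda>_. 1) \<bullet> (B *\<^sub>v vec n (\<lambda>_. 1))"
proof -
  let ?A = "ratfun_x \<cdot>\<^sub>m 1\<^sub>m n - M"
  have A: "?A \<in> carrier_mat n n"
    using M by auto
  have inv': "B * ?A = 1\<^sub>m n"
    using mat_mult_left_right_inverse[OF A B inv] .
  have "?A \<in> Units (ring_mat TYPE(ratfun) n ())"
    using A B inv inv' unfolding Units_def by (auto simp: ring_mat_def)
  then obtain C where C: "mat_inverse ?A = Some C"
    using mat_inverse(1)[OF A, where b = "()"] by (cases "mat_inverse ?A") auto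
  have C': "?A * C = 1\<^sub>m n" "C \<in> carrier_mat n n"
    using mat_inverse(2)[OF A C] by auto
  have "B = B * (?A * C)"
    using B C' by simp
  also have "\<dots> = (B * ?A) * C"
    using assoc_mult_mat[OF B A C'(2)] by simp
  also have "\<dots> = C"
    using inv' C' by simp
  finally have "B = C" .
  then show ?thesis
    using M C by (simp add: coronal_def Let_def)
qed

lemma pair_graph_iff:
  "pair_graph G \<longleftrightarrow>
     finite (pverts G) \<and> parcs G \<subseteq> pverts G \<times> pverts G \<and> irrefl (parcs G) \<and> sym (parcs G)"
proof
  assume "pair_graph G"
  then interpret pair_graph G .
  show "finite (pverts G) \<and> parcs G \<subseteq> pverts G \<times> pverts G \<and> irrefl (parcs G) \<and> sym (parcs G)"
    using pair_finite_verts arc_fst_in_verts arc_snd_in_verts pair_no_loops pair_sym_arcs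
    by (fastforce simp: irrefl_def symmetric_def)
next
  assume *: "finite (pverts G) \<and> parcs G \<subseteq> pverts G \<times> pverts G \<and> irrefl (parcs G) \<and> sym (parcs G)"
  then have "finite (parcs G)"
    using finite_subset by blast
  then show "pair_graph G"
    using * by unfold_locales (auto simp: irrefl_def symmetric_def)
qed

lemma pair_graph_complement: "pair_graph G \<Longrightarrow> pair_graph (graph_complement G)"
  by (auto simp: pair_graph_iff graph_complement_def irrefl_def sym_def)

lemma pair_graph_join:
  "pair_graph G1 \<Longrightarrow> pair_graph G2 \<Longrightarrow> pverts G1 \<inter> pverts G2 = {} \<Longrightarrow> pair_graph (graph_join G1 G2)"
  unfolding pair_graph_iff graph_join_def irrefl_def sym_def by auto

lemma pair_graph_splitting_join:
  assumes "pair_graph G1" "pair_graph G2" "pverts G1 \<inter> pverts G2 = {}"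
  shows "pair_graph (splitting_join R G1 G2)"
proof -
  have "pair_graph (graph_join G1 G2)"
    using assms by (rule pair_graph_join)
  moreover have "pverts G1 \<subseteq> pverts (graph_join G1 G2)" "finite (pverts G1)"
    using assms by (auto simp: graph_join_def pair_graph_iff)
  ultimately show ?thesis
    unfolding pair_graph_iff splitting_join_def irrefl_def sym_def by auto
qed

end

(*
  Enumerate the splitting join as V(G1), V(G2), copies of V(G1). The copies form an independent
  set, so their diagonal block of xI - A is xI; eliminating it (Schur complement) contributes x^n1
  and replaces xI - A1 by N = xI - A1 - K^2/x, where K is the symmetric matrix of the splitting
  relation. Eliminating xI - A2 next contributes its determinant and subtracts from N the matrix J
  scaled by the coronal of A2; the rank-one determinant formula then produces the coronal of
  A1 + K^2/x. The matrix N is invertible over the rational functions because x^n1 det N is the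
  characteristic polynomial of the block matrix [A1, K; K, 0], which is monic.
*)

theory Submission
  imports Defs "Subresultants.More_Homomorphisms"
begin

section \<open>Independence of the characteristic polynomial from the vertex order\<close>

text \<open>Duplicate-free lists with the same elements differ by a permutation. It acts on rows and
  columns alike, so its sign enters twice and squares to 1.\<close>

lemma det_list_reindex:
  fixes f :: "'b \<Rightarrow> 'b \<Rightarrow> 'c :: comm_ring_1"
  assumes xs: "distinct xs" and ys: "distinct ys" and eq: "set xs = set ys"
  shows "det (mat (length xs) (length xs) (\<lambda>(i, j). f (xs ! i) (xs ! j))) =
    det (mat (length ys) (length ys) (\<lambda>(i, j). f (ys ! i) (ys ! j)))"
proof -
  define n where "n = length ys"
  have len: "length xs = n"
    using xs ys eq by (metis distinct_card n_def)
  have "mset xs = mset ys"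
    using xs ys eq by (simp add: set_eq_iff_mset_eq_distinct)
  then obtain p where p: "p permutes {..<length ys}" and perm: "permute_list p ys = xs"
    by (rule mset_eq_permutation)
  have p': "p permutes {0..<n}"
    using p by (simp add: n_def atLeast0LessThan)
  have lt: "p i < n" if "i < n" for i
    using permutes_in_image[OF p', of i] that by simp
  have nth: "xs ! i = ys ! p i" if "i < n" for i
    using permute_list_nth[OF p, of i] that by (simp add: perm n_def)
  define A where "A = mat n n (\<lambda>(i, j). f (ys ! i) (ys ! j))"
  define B where "B = mat n n (\<lambda>(i, j). A $$ (p i, j))"
  have A: "A \<in> carrier_mat n n" and B: "B \<in> carrier_mat n n"
    by (simp_all add: A_def B_def)
  \<comment> \<open>\<open>B\<close> has the rows of \<open>A\<close> permuted by \<open>p\<close>.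
    The columns are permuted as rows of the transpose, so that \<open>det_permute_rows\<close>
    serves both times.\<close>
  have "mat n n (\<lambda>(i, j). f (xs ! i) (xs ! j)) =
      transpose_mat (mat n n (\<lambda>(i, j). transpose_mat B $$ (p i, j)))"
    by (rule eq_matI) (auto simp: A_def B_def nth lt)
  then have "det (mat n n (\<lambda>(i, j). f (xs ! i) (xs ! j))) =
      det (mat n n (\<lambda>(i, j). transpose_mat B $$ (p i, j)))"
    by (simp add: det_transpose[of _ n])
  also have "\<dots> = signof p * det B"
    using det_permute_rows[OF _ p', of "transpose_mat B"] B det_transpose[OF B] by simp
  also have "\<dots> = signof p * signof p * det A"
    using det_permute_rows[OF A p'] by (simp add: B_def mult.assoc)
  also have "signof p * signof p = (1 :: 'c)"
    by (simp add: sign_def)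
  finally show ?thesis
    by (simp add: len A_def n_def)
qed

text \<open>This permits replacing an arbitrary enumeration of the splitting join by one in which
  the adjacency matrix has block form.\<close>

lemma char_poly_vertex_enum:
  assumes "vertex_enum xs G" and "vertex_enum ys G"
  shows "char_poly (adjacency_matrix xs G) = char_poly (adjacency_matrix ys G)"
proof -
  \<comment> \<open>Entries must depend on vertices rather than positions; distinctness of the list
    turns the diagonal condition \<open>i = j\<close> into \<open>u = v\<close>.\<close>
  define f :: "'a \<Rightarrow> 'a \<Rightarrow> real poly" where
    "f u v = (if u = v then [:0, 1:] else 0) + [:- (if (u, v) \<in> parcs G then 1 else 0):]" for u v
  have *: "char_poly_matrix (adjacency_matrix zs G) =
      mat (length zs) (length zs) (\<lambda>(i, j). f (zs ! i) (zs ! j))" if "distinct zs" for zs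
    by (rule eq_matI)
      (use that in \<open>auto simp: char_poly_matrix_def adjacency_matrix_def f_def nth_eq_iff_index_eq\<close>)
  show ?thesis
    using assms det_list_reindex[of xs ys f] by (simp add: char_poly_def * vertex_enum_def)
qed

section \<open>All-ones blocks and the passage to rational functions\<close>

definition ones_mat :: "nat \<Rightarrow> nat \<Rightarrow> 'b :: one mat" where
  "ones_mat n m = mat n m (\<lambda>_. 1)"

lemma ones_mat_carrier [simp]: "ones_mat n m \<in> carrier_mat n m"
  and dim_ones_mat [simp]: "dim_row (ones_mat n m) = n" "dim_col (ones_mat n m) = m"
  by (simp_all add: ones_mat_def)

lemma ratfun_mat_carrier [simp]: "ratfun_mat A \<in> carrier_mat n m \<longleftrightarrow> A \<in> carrier_mat n m"
  by (simp add: ratfun_mat_def)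

lemma ratfun_mat_ones [simp]: "ratfun_mat (ones_mat n m) = ones_mat n m"
  by (rule eq_matI) (auto simp: ratfun_mat_def ones_mat_def one_pCons[symmetric])

lemma ratfun_mat_zero [simp]: "ratfun_mat (0\<^sub>m n m) = 0\<^sub>m n m"
  by (rule eq_matI) (auto simp: ratfun_mat_def)

lemma ratfun_mat_four_block:
  assumes "A \<in> carrier_mat n k" and "B \<in> carrier_mat n l"
    and "C \<in> carrier_mat m k" and "D \<in> carrier_mat m l"
  shows "ratfun_mat (four_block_mat A B C D) =
    four_block_mat (ratfun_mat A) (ratfun_mat B) (ratfun_mat C) (ratfun_mat D)"
  unfolding ratfun_mat_def by (rule map_four_block_mat[OF assms])

lemma scalar_minus_four_block_mat:
  fixes A :: "'b :: ring_1 mat"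
  assumes "A \<in> carrier_mat n n" and "B \<in> carrier_mat n m"
    and "C \<in> carrier_mat m n" and "D \<in> carrier_mat m m"
  shows "x \<cdot>\<^sub>m 1\<^sub>m (n + m) - four_block_mat A B C D =
    four_block_mat (x \<cdot>\<^sub>m 1\<^sub>m n - A) (- B) (- C) (x \<cdot>\<^sub>m 1\<^sub>m m - D)"
  by (rule eq_matI) (use assms in auto)

text \<open>Determinants commute with the ring homomorphism \<open>to_fract\<close>. From here on
  the computation takes place over a field, where \<open>xI - A\<close> can be inverted.\<close>

lemma to_fract_char_poly:
  assumes "A \<in> carrier_mat n n"
  shows "to_fract (char_poly A) = det (ratfun_x \<cdot>\<^sub>m 1\<^sub>m n - ratfun_mat A)"
proof -
  have "map_mat to_fract (char_poly_matrix A) = ratfun_x \<cdot>\<^sub>m 1\<^sub>m n - ratfun_mat A"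
    by (rule eq_matI)
      (use assms in \<open>auto simp: char_poly_matrix_def ratfun_x_def ratfun_mat_def
        simp flip: to_fract_add to_fract_uminus to_fract_diff\<close>)
  then show ?thesis
    by (simp add: char_poly_def flip: to_fract_hom.hom_det)
qed

text \<open>A characteristic polynomial is monic, hence nonzero, and \<open>to_fract\<close> is
  injective.\<close>

lemma det_char_mat_nonzero:
  assumes "A \<in> carrier_mat n n"
  shows "det (ratfun_x \<cdot>\<^sub>m 1\<^sub>m n - ratfun_mat A) \<noteq> 0"
proof -
  have "char_poly A \<noteq> 0"
    using degree_monic_char_poly[OF assms] by (metis coeff_0 zero_neq_one)
  then show ?thesis
    by (simp flip: to_fract_char_poly[OF assms])
qed

lemma ratfun_x_nonzero [simp]: "ratfun_x \<noteq> 0"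
  by (simp add: ratfun_x_def)

section \<open>Inverses and Schur complements\<close>

lemma det_nonzero_obtain_inverse:
  fixes A :: "'b :: field mat"
  assumes "A \<in> carrier_mat n n" and "det A \<noteq> 0"
  obtains B where "B \<in> carrier_mat n n" and "A * B = 1\<^sub>m n" and "B * A = 1\<^sub>m n"
  using det_non_zero_imp_unit[OF assms, of "()"] by (auto simp: Units_def ring_mat_def)

lemma mat_diff_add_cancel:
  fixes A :: "'b :: ab_group_add mat"
  assumes "A \<in> carrier_mat n m" and "B \<in> carrier_mat n m"
  shows "A - B + B = A" and "B + (A - B) = A"
  by (rule eq_matI; use assms in simp)+

text \<open>The matrix factors as \<open>[A - B E C, B; 0, D]\<close> times
  \<open>[1, 0; E C, 1]\<close>. Both factors are block triangular and the second has determinant 1.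
  Passing the inverse \<open>E\<close> of \<open>D\<close> as an argument keeps the lemma valid over
  an integral domain.\<close>

lemma det_schur_lower_right:
  fixes A :: "'b :: idom mat"
  assumes A: "A \<in> carrier_mat n n" and B: "B \<in> carrier_mat n m"
    and C: "C \<in> carrier_mat m n" and D: "D \<in> carrier_mat m m"
    and E: "E \<in> carrier_mat m m" and inv: "D * E = 1\<^sub>m m"
  shows "det (four_block_mat A B C D) = det (A - B * (E * C)) * det D"
proof -
  have EC: "E * C \<in> carrier_mat m n" and BEC: "B * (E * C) \<in> carrier_mat n n"
    using B C E by auto
  have "D * (E * C) = C"
    using assoc_mult_mat[OF D E C] C by (simp add: inv)
  moreover have "A - B * (E * C) + B * (E * C) = A"
    using A BEC by (rule mat_diff_add_cancel)
  ultimately have "four_block_mat (A - B * (E * C)) B (0\<^sub>m m n) D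
      * four_block_mat (1\<^sub>m n) (0\<^sub>m n m) (E * C) (1\<^sub>m m) = four_block_mat A B C D"
    using A B C D EC BEC
    by (subst mult_four_block_mat[where ?nr1.0 = n and ?n1.0 = n and ?n2.0 = m and ?nr2.0 = m
          and ?nc1.0 = n and ?nc2.0 = m])
      (auto simp: minus_carrier_mat[OF BEC])
  then have "det (four_block_mat A B C D) =
      det (four_block_mat (A - B * (E * C)) B (0\<^sub>m m n) D)
      * det (four_block_mat (1\<^sub>m n) (0\<^sub>m n m) (E * C) (1\<^sub>m m))"
    using A D BEC by (subst det_mult[symmetric, where n = "n + m"]) (auto simp: minus_carrier_mat)
  then show ?thesis
    using B D EC BEC
    by (simp add: det_four_block_mat_lower_left_zero[where n = n and m = m]
        det_four_block_mat_upper_right_zero[where n = n and m = m] minus_carrier_mat)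
qed

text \<open>The mirror image: \<open>[A, 0; C, D - C E B]\<close> times
  \<open>[1, E B; 0, 1]\<close>.\<close>

lemma det_schur_upper_left:
  fixes A :: "'b :: idom mat"
  assumes A: "A \<in> carrier_mat n n" and B: "B \<in> carrier_mat n m"
    and C: "C \<in> carrier_mat m n" and D: "D \<in> carrier_mat m m"
    and E: "E \<in> carrier_mat n n" and inv: "A * E = 1\<^sub>m n"
  shows "det (four_block_mat A B C D) = det A * det (D - C * (E * B))"
proof -
  have EB: "E * B \<in> carrier_mat n m" and CEB: "C * (E * B) \<in> carrier_mat m m"
    using B C E by auto
  have "A * (E * B) = B"
    using assoc_mult_mat[OF A E B] B by (simp add: inv)
  moreover have "C * (E * B) + (D - C * (E * B)) = D"
    using D CEB by (rule mat_diff_add_cancel)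
  ultimately have "four_block_mat A (0\<^sub>m n m) C (D - C * (E * B))
      * four_block_mat (1\<^sub>m n) (E * B) (0\<^sub>m m n) (1\<^sub>m m) = four_block_mat A B C D"
    using A B C D EB CEB
    by (subst mult_four_block_mat[where ?nr1.0 = n and ?n1.0 = n and ?n2.0 = m and ?nr2.0 = m
          and ?nc1.0 = n and ?nc2.0 = m])
      (auto simp: minus_carrier_mat[OF CEB])
  then have "det (four_block_mat A B C D) =
      det (four_block_mat A (0\<^sub>m n m) C (D - C * (E * B)))
      * det (four_block_mat (1\<^sub>m n) (E * B) (0\<^sub>m m n) (1\<^sub>m m))"
    using A D CEB by (subst det_mult[symmetric, where n = "n + m"]) (auto simp: minus_carrier_mat)
  then show ?thesis
    using A C EB CEB
    by (simp add: det_four_block_mat_lower_left_zero[where n = n and m = m]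
        det_four_block_mat_upper_right_zero[where n = n and m = m] minus_carrier_mat)
qed

section \<open>Entry sums, the rank-one update and the join determinant\<close>

text \<open>The form follows \<open>coronal\<close>, which thereby becomes the
  \<open>entry_sum\<close> of the inverse of \<open>xI - M\<close>.\<close>

abbreviation entry_sum :: "'b :: semiring_1 mat \<Rightarrow> 'b" where
  "entry_sum M \<equiv> vec (dim_row M) (\<lambda>_. 1) \<bullet> (M *\<^sub>v vec (dim_col M) (\<lambda>_. 1))"

text \<open>Every entry of the product is the same number: an all-ones row times \<open>M\<close>
  times an all-ones column.\<close>

lemma ones_mat_sandwich:
  fixes M :: "'b :: semiring_1 mat"
  assumes M: "M \<in> carrier_mat n m"
  shows "ones_mat k n * (M * ones_mat m l) = entry_sum M \<cdot>\<^sub>m ones_mat k l"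
proof (rule eq_matI)
  fix i j
  assume "i < dim_row (entry_sum M \<cdot>\<^sub>m ones_mat k l)" "j < dim_col (entry_sum M \<cdot>\<^sub>m ones_mat k l)"
  then have i: "i < k" and j: "j < l"
    by simp_all
  have "row (ones_mat k n) i = vec n (\<lambda>_. 1 :: 'b)" "col (ones_mat m l) j = vec m (\<lambda>_. 1 :: 'b)"
    using i j by (auto simp: ones_mat_def)
  moreover have "ones_mat k l $$ (i, j) = (1 :: 'b)"
    using i j by (simp add: ones_mat_def)
  ultimately show "(ones_mat k n * (M * ones_mat m l)) $$ (i, j) = (entry_sum M \<cdot>\<^sub>m ones_mat k l) $$ (i, j)"
    using M i j by (simp add: col_mult2[OF M ones_mat_carrier])
qed (use M in auto)

text \<open>The matrix determinant lemma for the rank-one matrix \<open>c J\<close>, with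
  \<open>J\<close> all ones, obtained by evaluating one bordered determinant in two ways.\<close>

lemma det_minus_smult_ones_mat:
  fixes N :: "'b :: idom mat"
  assumes N: "N \<in> carrier_mat n n" and E: "E \<in> carrier_mat n n" and inv: "N * E = 1\<^sub>m n"
  shows "det (N - c \<cdot>\<^sub>m ones_mat n n) = det N * (1 - c * entry_sum E)"
proof -
  \<comment> \<open>Eliminating the corner 1 leaves \<open>N - c J\<close>; eliminating
    \<open>N\<close> leaves the scalar \<open>1 - c * entry_sum E\<close>.\<close>
  let ?M = "four_block_mat N (ones_mat n 1) (c \<cdot>\<^sub>m ones_mat 1 n) (1\<^sub>m 1)"
  have "ones_mat n 1 * (1\<^sub>m 1 * (c \<cdot>\<^sub>m ones_mat 1 n)) = c \<cdot>\<^sub>m ones_mat n n"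
    by (rule eq_matI) (auto simp: ones_mat_def scalar_prod_def)
  then have M: "det ?M = det (N - c \<cdot>\<^sub>m ones_mat n n)"
    using N by (subst det_schur_lower_right[where E = "1\<^sub>m 1"]) auto
  have "c \<cdot>\<^sub>m ones_mat 1 n * (E * ones_mat n 1) = (c * entry_sum E) \<cdot>\<^sub>m ones_mat 1 1"
    using ones_mat_sandwich[OF E, of 1 1] E
    by (subst mult_smult_assoc_mat[of _ 1 n _ 1]) (auto intro!: eq_matI)
  moreover have "det (1\<^sub>m 1 - k \<cdot>\<^sub>m ones_mat 1 1) = 1 - k" for k :: 'b
    by (subst det_single) (auto simp: ones_mat_def)
  ultimately have "det ?M = det N * (1 - c * entry_sum E)"
    using N E inv by (subst det_schur_upper_left[where E = E]) auto
  then show ?thesis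
    by (simp only: M)
qed

text \<open>Eliminating \<open>P\<close> subtracts \<open>entry_sum F\<close> times the all-ones
  matrix from \<open>N\<close>, the two minus signs cancelling; the rank-one formula finishes. For
  \<open>N\<close> and \<open>P\<close> of the form \<open>xI - A\<close> this is the determinant of
  an ordinary join.\<close>

lemma det_join_block:
  fixes N P :: "'b :: idom mat"
  assumes N: "N \<in> carrier_mat n n" and E: "E \<in> carrier_mat n n" and NE: "N * E = 1\<^sub>m n"
    and P: "P \<in> carrier_mat m m" and F: "F \<in> carrier_mat m m" and PF: "P * F = 1\<^sub>m m"
  shows "det (four_block_mat N (- ones_mat n m) (- ones_mat m n) P) =
    det P * det N * (1 - entry_sum F * entry_sum E)"
proof -
  have "- ones_mat n m * (F * - ones_mat m n) = entry_sum F \<cdot>\<^sub>m ones_mat n n"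
    using ones_mat_sandwich[OF F, of n n] F by simp
  then show ?thesis
    using N P F PF det_minus_smult_ones_mat[OF N E NE]
    by (subst det_schur_lower_right[where E = F]) auto
qed


section \<open>Eliminating the copied vertices\<close>

text \<open>The inverse of the scalar block is \<open>1 / x\<close> times the identity and its
  determinant is \<open>x ^ m\<close>: the origin of both the factor \<open>1 / x\<close> and the
  power of \<open>x\<close> in the theorem.\<close>

lemma det_schur_scalar_block:
  fixes A :: "'b :: field mat"
  assumes A: "A \<in> carrier_mat n n" and B: "B \<in> carrier_mat n m" and C: "C \<in> carrier_mat m n"
    and x: "x \<noteq> 0"
  shows "det (four_block_mat A B C (x \<cdot>\<^sub>m 1\<^sub>m m)) = x ^ m * det (A - (1 / x) \<cdot>\<^sub>m (B * C))"
proof -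
  have "B * ((1 / x) \<cdot>\<^sub>m 1\<^sub>m m * C) = (1 / x) \<cdot>\<^sub>m (B * C)"
    using B C by (simp add: mult_smult_assoc_mat[of _ m m _ n] mult_smult_distrib[of _ n m _ n])
  moreover have "(x \<cdot>\<^sub>m 1\<^sub>m m) * ((1 / x) \<cdot>\<^sub>m 1\<^sub>m m) = 1\<^sub>m m"
    using x by (intro eq_matI) auto
  ultimately show ?thesis
    using A B C by (subst det_schur_lower_right[where E = "(1 / x) \<cdot>\<^sub>m 1\<^sub>m m"]) auto
qed

lemma uminus_mult_uminus_mat:
  fixes A B :: "'b :: ring mat"
  assumes "A \<in> carrier_mat n m" and "B \<in> carrier_mat m l"
  shows "(- A) * (- B) = A * B"
  using assms by simp

text \<open>Copies are adjacent only to vertices of the first graph, so eliminating them alters only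
  the block \<open>A\<close>, which becomes \<open>N\<close>; what remains is a join block.\<close>

lemma det_splitting_join_block:
  fixes A P K :: "'b :: field mat"
  assumes A: "A \<in> carrier_mat n n" and K: "K \<in> carrier_mat n n"
    and N: "N = A - (1 / x) \<cdot>\<^sub>m (K * K)"
    and E: "E \<in> carrier_mat n n" and NE: "N * E = 1\<^sub>m n"
    and P: "P \<in> carrier_mat m m" and F: "F \<in> carrier_mat m m" and PF: "P * F = 1\<^sub>m m"
    and x: "x \<noteq> 0"
  shows "det (four_block_mat
      (four_block_mat A (- ones_mat n m) (- ones_mat m n) P)
      (- four_block_mat K (0\<^sub>m n 0) (0\<^sub>m m n) (0\<^sub>m m 0))
      (- four_block_mat K (0\<^sub>m n m) (0\<^sub>m 0 n) (0\<^sub>m 0 m)) (x \<cdot>\<^sub>m 1\<^sub>m n)) =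
    x ^ n * det P * det N * (1 - entry_sum F * entry_sum E)"
proof -
  \<comment> \<open>The tall matrix \<open>[K; 0]\<close> and the wide matrix \<open>[K, 0]\<close>
    are written with blocks of width or height 0, so that block multiplication applies to
    them.\<close>
  let ?L = "four_block_mat K (0\<^sub>m n 0) (0\<^sub>m m n) (0\<^sub>m m 0)"
  let ?U = "four_block_mat K (0\<^sub>m n m) (0\<^sub>m 0 n) (0\<^sub>m 0 m)"
  have KK: "K * K \<in> carrier_mat n n"
    using K by auto
  have L: "?L \<in> carrier_mat (n + m) n" and U: "?U \<in> carrier_mat n (n + m)"
    using K four_block_carrier_mat[of K n n "0\<^sub>m m 0" m 0] four_block_carrier_mat[of K n n "0\<^sub>m 0 m" 0 m]
    by simp_all
  have "?L * ?U = four_block_mat (K * K) (0\<^sub>m n m) (0\<^sub>m m n) (0\<^sub>m m m)"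
    using K KK by (subst mult_four_block_mat[where ?nr1.0 = n and ?n1.0 = n and ?n2.0 = 0
          and ?nr2.0 = m and ?nc1.0 = n and ?nc2.0 = m]) auto
  then have LU: "(- ?L) * (- ?U) = four_block_mat (K * K) (0\<^sub>m n m) (0\<^sub>m m n) (0\<^sub>m m m)"
    by (simp only: uminus_mult_uminus_mat[OF L U])
  have "four_block_mat A (- ones_mat n m) (- ones_mat m n) P
      - (1 / x) \<cdot>\<^sub>m four_block_mat (K * K) (0\<^sub>m n m) (0\<^sub>m m n) (0\<^sub>m m m) =
      four_block_mat N (- ones_mat n m) (- ones_mat m n) P"
    by (rule eq_matI) (use A P K in \<open>auto simp: N\<close>)
  moreover have "N \<in> carrier_mat n n"
    using KK by (simp add: N minus_carrier_mat)
  ultimately show ?thesis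
    using A P L U x det_join_block[OF _ E NE P F PF]
    by (subst det_schur_scalar_block[where n = "n + m"]) (auto simp: LU)
qed

section \<open>Coronals and invertibility\<close>

lemma coronal_eq_entry_sum:
  assumes "M \<in> carrier_mat n n" and "B \<in> carrier_mat n n"
    and "(ratfun_x \<cdot>\<^sub>m 1\<^sub>m n - M) * B = 1\<^sub>m n"
  shows "coronal M = entry_sum B"
  using coronal_eqI[OF assms] assms(2) by simp

text \<open>The entries involve \<open>1 / ratfun_x\<close>, so monicity does not apply directly.
  The larger real matrix \<open>?M\<close> has constant entries and this matrix as a Schur
  complement.\<close>

lemma det_scalar_minus_square_nonzero:
  assumes A: "A \<in> carrier_mat n n" and K: "K \<in> carrier_mat n n"
  shows "det (ratfun_x \<cdot>\<^sub>m 1\<^sub>m n - ratfun_mat A - (1 / ratfun_x) \<cdot>\<^sub>m (ratfun_mat K * ratfun_mat K)) \<noteq> 0"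
proof -
  let ?A = "ratfun_mat A" and ?K = "ratfun_mat K"
  let ?M = "four_block_mat A K K (0\<^sub>m n n)"
  have "ratfun_x \<cdot>\<^sub>m 1\<^sub>m (n + n) - ratfun_mat ?M =
      four_block_mat (ratfun_x \<cdot>\<^sub>m 1\<^sub>m n - ?A) (- ?K) (- ?K) (ratfun_x \<cdot>\<^sub>m 1\<^sub>m n)"
    by (rule eq_matI) (use A K in \<open>auto simp: ratfun_mat_def\<close>)
  moreover have "?M \<in> carrier_mat (n + n) (n + n)"
    using A by auto
  ultimately have "det (four_block_mat (ratfun_x \<cdot>\<^sub>m 1\<^sub>m n - ?A) (- ?K) (- ?K) (ratfun_x \<cdot>\<^sub>m 1\<^sub>m n)) \<noteq> 0"
    using det_char_mat_nonzero by metis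
  moreover have "(- ?K) * (- ?K) = ?K * ?K"
    using K by (intro uminus_mult_uminus_mat) auto
  moreover have "ratfun_x \<cdot>\<^sub>m 1\<^sub>m n - ?A \<in> carrier_mat n n" "- ?K \<in> carrier_mat n n"
    using A K by (auto simp: ratfun_mat_def)
  \<comment> \<open>The nonzero determinant is \<open>ratfun_x ^ n\<close> times the one in
    question.\<close>
  ultimately show ?thesis
    by (subst (asm) det_schur_scalar_block[where n = n]) auto
qed

section \<open>The splitting join in block form\<close>

text \<open>The block between copies and originals, for a general \<open>R\<close> so that one
  computation covers both joins.\<close>

definition relation_matrix :: "'a list \<Rightarrow> ('a \<Rightarrow> 'a \<Rightarrow> bool) \<Rightarrow> real mat" where
  "relation_matrix us R =
     mat (length us) (length us) (\<lambda>(i, j). if R (us ! i) (us ! j) then 1 else 0)"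

lemma adjacency_matrix_carrier [simp]:
  "adjacency_matrix us G \<in> carrier_mat (length us) (length us)"
  by (simp add: adjacency_matrix_def)

lemma relation_matrix_carrier [simp]:
  "relation_matrix us R \<in> carrier_mat (length us) (length us)"
  by (simp add: relation_matrix_def)

text \<open>The arcs from originals to copies give the transpose of the relation matrix; symmetry of
  \<open>R\<close> makes it equal to the block below the diagonal.\<close>

lemma adjacency_matrix_splitting_join:
  assumes "pair_graph G1" and "pair_graph G2" and "pverts G1 \<inter> pverts G2 = {}"
    and "set us = pverts G1" and "set vs = pverts G2"
    and "\<And>u v. u \<in> pverts G1 \<Longrightarrow> v \<in> pverts G1 \<Longrightarrow> R u v \<longleftrightarrow> R v u"
    and n: "n = length us" and m: "m = length vs"
  shows "adjacency_matrix (map Orig us @ map Orig vs @ map Copy us) (splitting_join R G1 G2) =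
    four_block_mat
      (four_block_mat (adjacency_matrix us G1) (ones_mat n m) (ones_mat m n) (adjacency_matrix vs G2))
      (four_block_mat (relation_matrix us R) (0\<^sub>m n 0) (0\<^sub>m m n) (0\<^sub>m m 0))
      (four_block_mat (relation_matrix us R) (0\<^sub>m n m) (0\<^sub>m 0 n) (0\<^sub>m 0 m)) (0\<^sub>m n n)"
proof -
  have us: "us ! i \<in> pverts G1" "us ! i \<notin> pverts G2" if "i < n" for i
    using that assms nth_mem[of i us] by auto
  have vs: "vs ! i \<in> pverts G2" "vs ! i \<notin> pverts G1" if "i < m" for i
    using that assms nth_mem[of i vs] by auto
  have arcs: "parcs G1 \<subseteq> pverts G1 \<times> pverts G1" "parcs G2 \<subseteq> pverts G2 \<times> pverts G2"
    using assms by (auto simp: pair_graph_iff)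
  have nth: "(map Orig us @ map Orig vs @ map Copy us) ! i =
      (if i < n then Orig (us ! i) else if i < n + m then Orig (vs ! (i - n))
       else Copy (us ! (i - n - m)))" if "i < n + m + n" for i
    using that by (auto simp: nth_append n m)
  have OO: "(Orig u, Orig v) \<in> parcs (splitting_join R G1 G2) \<longleftrightarrow>
      (u, v) \<in> parcs G1 \<or> (u, v) \<in> parcs G2 \<or> (u \<in> pverts G1 \<and> v \<in> pverts G2)
      \<or> (u \<in> pverts G2 \<and> v \<in> pverts G1)" for u v
    by (auto simp: splitting_join_def graph_join_def)
  have OC: "(Orig v, Copy u) \<in> parcs (splitting_join R G1 G2) \<longleftrightarrow>
        u \<in> pverts G1 \<and> v \<in> pverts G1 \<and> R u v"
    and CO: "(Copy u, Orig v) \<in> parcs (splitting_join R G1 G2) \<longleftrightarrow>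
        u \<in> pverts G1 \<and> v \<in> pverts G1 \<and> R u v"
    and CC: "(Copy u, Copy v) \<notin> parcs (splitting_join R G1 G2)" for u v
    by (auto simp: splitting_join_def)
  \<comment> \<open>Since the vertex sets are disjoint, arcs of one graph contribute nothing to the
    blocks outside its own diagonal block.\<close>
  have noarc: "(u, v) \<notin> parcs G1" if "u \<notin> pverts G1 \<or> v \<notin> pverts G1" for u v
    using arcs that by auto
  have noarc': "(u, v) \<notin> parcs G2" if "u \<notin> pverts G2 \<or> v \<notin> pverts G2" for u v
    using arcs that by auto
  show ?thesis
    by (rule eq_matI)
      (auto simp: adjacency_matrix_def relation_matrix_def ones_mat_def nth OO OC CO CC us vs
        noarc noarc' assms(6) simp flip: n m)
qed

text \<open>Both identities of the theorem are instances: only symmetry of \<open>R\<close> matters,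
  and \<open>K\<close> becomes the matrix of the graph or of its complement.\<close>

lemma char_poly_splitting_join:
  assumes G: "pair_graph G1" "pair_graph G2" "pverts G1 \<inter> pverts G2 = {}"
    and us: "vertex_enum us G1" and vs: "vertex_enum vs G2"
    and ws: "vertex_enum ws (splitting_join R G1 G2)"
    and sym: "\<And>u v. u \<in> pverts G1 \<Longrightarrow> v \<in> pverts G1 \<Longrightarrow> R u v \<longleftrightarrow> R v u"
    and n: "n = card (pverts G1)"
    and A1: "A1 = ratfun_mat (adjacency_matrix us G1)"
    and A2: "A2 = ratfun_mat (adjacency_matrix vs G2)"
    and K: "K = ratfun_mat (relation_matrix us R)"
  shows "to_fract (char_poly (adjacency_matrix ws (splitting_join R G1 G2))) =
    ratfun_x ^ n * to_fract (char_poly (adjacency_matrix vs G2))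
    * det (ratfun_x \<cdot>\<^sub>m 1\<^sub>m n - A1 - (1 / ratfun_x) \<cdot>\<^sub>m (K ^\<^sub>m 2))
    * (1 - coronal A2 * coronal (A1 + (1 / ratfun_x) \<cdot>\<^sub>m (K ^\<^sub>m 2)))"
proof -
  define m where "m = length vs"
  have n': "n = length us"
    using us distinct_card[of us] by (simp add: vertex_enum_def n)
  have carrier: "A1 \<in> carrier_mat n n" "K \<in> carrier_mat n n" "A2 \<in> carrier_mat m m"
    by (simp_all add: A1 A2 K n' m_def)
  have KK: "K ^\<^sub>m 2 = K * K" "K * K \<in> carrier_mat n n"
    using carrier by (simp_all add: numeral_2_eq_2)
  let ?A = "ratfun_x \<cdot>\<^sub>m 1\<^sub>m n - A1"
  let ?N = "?A - (1 / ratfun_x) \<cdot>\<^sub>m (K * K)" and ?P = "ratfun_x \<cdot>\<^sub>m 1\<^sub>m m - A2"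
  have A: "?A \<in> carrier_mat n n" and N: "?N \<in> carrier_mat n n" and P: "?P \<in> carrier_mat m m"
    using carrier KK by auto
  have "det ?N \<noteq> 0" "det ?P \<noteq> 0"
    using det_scalar_minus_square_nonzero[of _ n] det_char_mat_nonzero[of _ m]
    by (simp_all add: A1 A2 K n' m_def)
  then obtain E F where E: "E \<in> carrier_mat n n" "?N * E = 1\<^sub>m n"
    and F: "F \<in> carrier_mat m m" "?P * F = 1\<^sub>m m"
    using det_nonzero_obtain_inverse[OF N] det_nonzero_obtain_inverse[OF P] by metis
  \<comment> \<open>Rebracketing shows that \<open>E\<close>, the inverse of the Schur complement,
    is also the inverse that defines the coronal of \<open>A1 + K^2/x\<close>.\<close>
  have "?N = ratfun_x \<cdot>\<^sub>m 1\<^sub>m n - (A1 + (1 / ratfun_x) \<cdot>\<^sub>m (K * K))"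
    using carrier by (intro eq_matI) auto
  then have cor1: "coronal (A1 + (1 / ratfun_x) \<cdot>\<^sub>m (K * K)) = entry_sum E"
    using carrier KK E by (intro coronal_eq_entry_sum) auto
  have cor2: "coronal A2 = entry_sum F"
    using carrier F by (intro coronal_eq_entry_sum)
  let ?es = "map Orig us @ map Orig vs @ map Copy us"
  have "vertex_enum ?es (splitting_join R G1 G2)"
    using us vs G(3)
    by (auto simp: vertex_enum_def splitting_join_def graph_join_def distinct_map inj_on_def)
  then have "char_poly (adjacency_matrix ws (splitting_join R G1 G2)) =
      char_poly (adjacency_matrix ?es (splitting_join R G1 G2))"
    by (rule char_poly_vertex_enum[OF ws])
  also have "to_fract \<dots> =
      det (ratfun_x \<cdot>\<^sub>m 1\<^sub>m (n + m + n)
        - ratfun_mat (adjacency_matrix ?es (splitting_join R G1 G2)))"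
    by (rule to_fract_char_poly) (auto simp: adjacency_matrix_def n' m_def)
  also have "ratfun_x \<cdot>\<^sub>m 1\<^sub>m (n + m + n)
        - ratfun_mat (adjacency_matrix ?es (splitting_join R G1 G2)) =
      four_block_mat
        (four_block_mat ?A (- ones_mat n m) (- ones_mat m n) ?P)
        (- four_block_mat K (0\<^sub>m n 0) (0\<^sub>m m n) (0\<^sub>m m 0))
        (- four_block_mat K (0\<^sub>m n m) (0\<^sub>m 0 n) (0\<^sub>m 0 m)) (ratfun_x \<cdot>\<^sub>m 1\<^sub>m n)"
  \<comment> \<open>\<open>ratfun_mat\<close> and the subtraction from \<open>xI\<close> are pushed
    through the nested blocks, the outer level first. The copies span no arcs, so their corner is
    \<open>xI - 0\<close>.\<close>
  proof -
    have "set us = pverts G1" "set vs = pverts G2"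
      using us vs by (simp_all add: vertex_enum_def)
    note adj = adjacency_matrix_splitting_join[OF G this _ n' m_def]
    have M: "adjacency_matrix us G1 \<in> carrier_mat n n" "adjacency_matrix vs G2 \<in> carrier_mat m m"
      "relation_matrix us R \<in> carrier_mat n n"
      by (simp_all add: n' m_def)
    let ?L = "four_block_mat (relation_matrix us R) (0\<^sub>m n 0) (0\<^sub>m m n) (0\<^sub>m m 0)"
    let ?U = "four_block_mat (relation_matrix us R) (0\<^sub>m n m) (0\<^sub>m 0 n) (0\<^sub>m 0 m)"
    let ?T = "four_block_mat (adjacency_matrix us G1) (ones_mat n m) (ones_mat m n)
      (adjacency_matrix vs G2)"
    have T: "?T \<in> carrier_mat (n + m) (n + m)" and L: "?L \<in> carrier_mat (n + m) n"
      and U: "?U \<in> carrier_mat n (n + m)"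
      using four_block_carrier_mat[OF M(1,2)] four_block_carrier_mat[OF M(3), of "0\<^sub>m m 0" m 0]
        four_block_carrier_mat[OF M(3), of "0\<^sub>m 0 m" 0 m] by simp_all
    have rT: "ratfun_mat ?T = four_block_mat A1 (ones_mat n m) (ones_mat m n) A2"
      by (subst ratfun_mat_four_block[OF M(1) _ _ M(2)]) (simp_all add: A1 A2)
    have rL: "ratfun_mat ?L = four_block_mat K (0\<^sub>m n 0) (0\<^sub>m m n) (0\<^sub>m m 0)"
      by (subst ratfun_mat_four_block[OF M(3), where l = 0 and m = m]) (simp_all add: K)
    have rU: "ratfun_mat ?U = four_block_mat K (0\<^sub>m n m) (0\<^sub>m 0 n) (0\<^sub>m 0 m)"
      by (subst ratfun_mat_four_block[OF M(3), where l = m and m = 0]) (simp_all add: K)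
    have "ratfun_mat (four_block_mat ?T ?L ?U (0\<^sub>m n n)) =
        four_block_mat (ratfun_mat ?T) (ratfun_mat ?L) (ratfun_mat ?U) (0\<^sub>m n n)"
      by (subst ratfun_mat_four_block[OF T L U]) simp_all
    then have "ratfun_x \<cdot>\<^sub>m 1\<^sub>m (n + m + n) - ratfun_mat (four_block_mat ?T ?L ?U (0\<^sub>m n n)) =
        four_block_mat (ratfun_x \<cdot>\<^sub>m 1\<^sub>m (n + m) - ratfun_mat ?T) (- ratfun_mat ?L)
          (- ratfun_mat ?U) (ratfun_x \<cdot>\<^sub>m 1\<^sub>m n - 0\<^sub>m n n)"
      using T L U by (simp only: ratfun_mat_carrier scalar_minus_four_block_mat zero_carrier_mat)
    moreover have "ratfun_x \<cdot>\<^sub>m 1\<^sub>m (n + m) - ratfun_mat ?T =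
        four_block_mat ?A (- ones_mat n m) (- ones_mat m n) ?P"
      unfolding rT using carrier by (intro scalar_minus_four_block_mat) simp_all
    moreover have "ratfun_x \<cdot>\<^sub>m 1\<^sub>m n - 0\<^sub>m n n = ratfun_x \<cdot>\<^sub>m 1\<^sub>m n"
      by (rule eq_matI) auto
    ultimately show ?thesis
      by (simp only: adj sym rL rU)
  qed
  also have "det \<dots> = ratfun_x ^ n * det ?P * det ?N * (1 - entry_sum F * entry_sum E)"
    using A carrier(2) P E F by (intro det_splitting_join_block) auto
  also have "det ?P = to_fract (char_poly (adjacency_matrix vs G2))"
    unfolding A2 by (rule to_fract_char_poly[symmetric]) (simp add: m_def)
  finally show ?thesis
    by (simp add: cor1 cor2 KK(1))
qed

section \<open>The two instances\<close>

lemma relation_matrix_adjacency: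
  "relation_matrix us (\<lambda>u v. (u, v) \<in> parcs G) = adjacency_matrix us G"
  by (simp add: relation_matrix_def adjacency_matrix_def)

text \<open>All entries of \<open>us\<close> are vertices of \<open>G\<close>, so the membership
  conditions in the complement hold automatically.\<close>

lemma relation_matrix_complement:
  assumes "set us = pverts G"
  shows "relation_matrix us (\<lambda>u v. u \<noteq> v \<and> (u, v) \<notin> parcs G) =
    adjacency_matrix us (graph_complement G)"
  by (rule eq_matI)
    (use assms nth_mem in \<open>fastforce simp: relation_matrix_def adjacency_matrix_def graph_complement_def\<close>)+


theorem theorem4p1:
  fixes G1 G2 :: "'a pair_pre_digraph"
    and us vs :: "'a list"
    and ws zs :: "'a split_vertex list"
    and n1 :: nat
    and A1 A1c A2 :: "ratfun mat"
  assumes "pair_graph G1" and "pair_graph G2"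
    and "pverts G1 \<inter> pverts G2 = {}"
    and "n1 = card (pverts G1)"
    and "vertex_enum us G1" and "vertex_enum vs G2"
    and "vertex_enum ws (NNS_join G1 G2)" and "vertex_enum zs (NS_join G1 G2)"
    and "A1 = ratfun_mat (adjacency_matrix us G1)"
    and "A1c = ratfun_mat (adjacency_matrix us (graph_complement G1))"
    and "A2 = ratfun_mat (adjacency_matrix vs G2)"
  shows
    "to_fract (char_poly (adjacency_matrix ws (NNS_join G1 G2))) =
       ratfun_x ^ n1 * to_fract (char_poly (adjacency_matrix vs G2))
       * det (ratfun_x \<cdot>\<^sub>m 1\<^sub>m n1 - A1 - (1 / ratfun_x) \<cdot>\<^sub>m (A1c ^\<^sub>m 2))
       * (1 - coronal A2 * coronal (A1 + (1 / ratfun_x) \<cdot>\<^sub>m (A1c ^\<^sub>m 2)))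
     \<and>
     to_fract (char_poly (adjacency_matrix zs (NS_join G1 G2))) =
       ratfun_x ^ n1 * to_fract (char_poly (adjacency_matrix vs G2))
       * det (ratfun_x \<cdot>\<^sub>m 1\<^sub>m n1 - A1 - (1 / ratfun_x) \<cdot>\<^sub>m (A1 ^\<^sub>m 2))
       * (1 - coronal A2 * coronal (A1 + (1 / ratfun_x) \<cdot>\<^sub>m (A1 ^\<^sub>m 2)))"
proof -
  \<comment> \<open>Symmetry of adjacency also gives symmetry of non-adjacency between distinct
    vertices, so it discharges the condition on \<open>R\<close> in both instances.\<close>
  have arcs_sym: "(u, v) \<in> parcs G1 \<longleftrightarrow> (v, u) \<in> parcs G1" for u v
    using assms(1) by (auto simp: pair_graph_iff dest: symD)
  have "set us = pverts G1"
    using assms(5) by (simp add: vertex_enum_def)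
  note rel = relation_matrix_complement[OF this] relation_matrix_adjacency
  show ?thesis
    using assms(7,8) unfolding NNS_join_def NS_join_def
    by (intro conjI char_poly_splitting_join[OF assms(1-3,5,6)])
      (use assms(4,9-11) arcs_sym in \<open>auto simp: rel\<close>)
qed

end
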